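(* Let $d$ be even and let $\underline{s}=(s_0,s_1,\dots ,s_d)$ be defined by $$s_k=\begin{cases} \dfrac{\binom{d}{d/2}\binom{d/2}{k/2}}{2^{d/2}\binom{d}{k}} & \text{if } k \text{ is even},\\[2mm] 0 & \text{if } k \text{ is odd}.\end{cases}$$ Then for every $d$-regular graph $G$, $F_G(s_0,\dots ,s_d)$ is equal to the number of Eulerian orientations of $G$.
   Context: Graphs are finite. For a $d$-regular graph $G$, the subgraph counting polynomial is $$F_G(x_0,x_1,\dots ,x_d)=\sum_{A \subseteq E(G)}\prod_{v\in V(G)}x_{d_A(v)},$$ where $d_A(v)$ is the degree of $v$ in the subgraph $(V(G),A)$. An Eulerian orientation of a graph with all degrees even is an orientation of its edges such that at each vertex the in-degree equals the out-degree. Connectedness is not assumed. *)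

theory Defs
  imports Complex_Main
begin

text \<open>A finite simple graph with vertex set \<open>V\<close> and edge set \<open>E\<close>; edges are 2-element sets of
  vertices. Neither connectedness nor nonemptiness is assumed.\<close>

definition finite_graph :: "'a set \<Rightarrow> 'a set set \<Rightarrow> bool" where
  "finite_graph V E \<longleftrightarrow> finite V \<and> (\<forall>e\<in>E. e \<subseteq> V \<and> card e = 2)"

definition degree_in :: "'a set set \<Rightarrow> 'a \<Rightarrow> nat" where
  "degree_in A v = card {e \<in> A. v \<in> e}"

definition regular_graph :: "nat \<Rightarrow> 'a set \<Rightarrow> 'a set set \<Rightarrow> bool" where
  "regular_graph d V E \<longleftrightarrow> finite_graph V E \<and> (\<forall>v\<in>V. degree_in E v = d)"

text \<open>The sequence \<open>x\<close> stands for the arguments \<open>x 0, \<dots>, x d\<close>; for a \<open>d\<close>-regular graph no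
  other entry of \<open>x\<close> is used, since no degree in a subgraph exceeds \<open>d\<close>.\<close>

definition subgraph_counting_poly ::
    "'a set \<Rightarrow> 'a set set \<Rightarrow> (nat \<Rightarrow> 'b::comm_semiring_1) \<Rightarrow> 'b" where
  "subgraph_counting_poly V E x = (\<Sum>A\<in>Pow E. \<Prod>v\<in>V. x (degree_in A v))"

text \<open>An orientation is the set \<open>D\<close> of its arcs \<open>(tail, head)\<close>: every arc lies over an edge, and
  every edge lies under exactly one arc.\<close>

definition orientation :: "'a set set \<Rightarrow> ('a \<times> 'a) set \<Rightarrow> bool" where
  "orientation E D \<longleftrightarrow> bij_betw (\<lambda>(u, v). {u, v}) D E"

definition out_degree :: "('a \<times> 'a) set \<Rightarrow> 'a \<Rightarrow> nat" where
  "out_degree D v = card {a \<in> D. fst a = v}"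

definition in_degree :: "('a \<times> 'a) set \<Rightarrow> 'a \<Rightarrow> nat" where
  "in_degree D v = card {a \<in> D. snd a = v}"

definition eulerian_orientations :: "'a set \<Rightarrow> 'a set set \<Rightarrow> ('a \<times> 'a) set set" where
  "eulerian_orientations V E =
    {D. orientation E D \<and> (\<forall>v\<in>V. in_degree D v = out_degree D v)}"

definition s_seq :: "nat \<Rightarrow> nat \<Rightarrow> real" where
  "s_seq d k =
    (if even k
     then real (d choose (d div 2)) * real ((d div 2) choose (k div 2))
            / (2 ^ (d div 2) * real (d choose k))
     else 0)"

end

theory Submission
  imports Defs "HOL-Combinatorics.Transposition" "HOL-Library.FuncSet"
begin

text \<open>Assign a spin \<open>\<plusminus>1\<close> to every half-edge, \<open>+1\<close> on the tail of an arc. An Eulerian orientation is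
  an assignment that is balanced at every vertex and takes opposite values on the two halves of
  every edge. The edge condition is detected by \<open>(1 - \<sigma>\<tau>) / 2\<close>; expanding the product of these
  factors over all edges gives a sum over \<open>A \<subseteq> E\<close> in which the sum over balanced assignments
  factorises over the vertices. The factor at a vertex depends only on its degree in \<open>A\<close>, and
  multiplying by the vanishing sum of all spins gives a two-term recursion which evaluates it
  to \<open>s\<^sub>k\<close> up to sign and a power of two.\<close>

section \<open>Balanced sign assignments on a finite set\<close>

definition spin :: "'b set \<Rightarrow> 'b \<Rightarrow> real" where
  "spin B e = (if e \<in> B then 1 else - 1)"

definition balanced_subsets :: "'b set \<Rightarrow> 'b set set" where
  "balanced_subsets S = {B. B \<subseteq> S \<and> 2 * card B = card S}"

text \<open>For finite \<open>S\<close> with \<open>card S = 2 * m\<close> and \<open>T\<close>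
  inside \<open>S\<close> this is the Krawtchouk value K_m(|T|; 2m), that is, an unnormalised Walsh
  coefficient of the indicator of the middle layer.\<close>

definition spin_sum :: "'b set \<Rightarrow> 'b set \<Rightarrow> real" where
  "spin_sum S T = (\<Sum>B\<in>balanced_subsets S. \<Prod>e\<in>T. spin B e)"

lemma spin_mult_self [simp]: "spin B e * spin B e = 1"
  by (simp add: spin_def)

lemma finite_balanced_subsets [simp]: "finite S \<Longrightarrow> finite (balanced_subsets S)"
  unfolding balanced_subsets_def by (rule finite_subset[of _ "Pow S"]) auto

lemma sum_spin_balanced:
  assumes "finite S" "B \<in> balanced_subsets S"
  shows "(\<Sum>e\<in>S. spin B e) = 0"
proof -
  have B: "B \<subseteq> S" "2 * card B = card S" using assms(2) by (auto simp: balanced_subsets_def)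
  have fB: "finite B" using B assms(1) finite_subset by blast
  have "(\<Sum>e\<in>S. spin B e) = (\<Sum>e\<in>S - B. spin B e) + (\<Sum>e\<in>B. spin B e)"
    using B assms(1) by (simp add: sum.subset_diff)
  also have "\<dots> = - real (card (S - B)) + real (card B)"
    by (simp add: spin_def)
  also have "card (S - B) = card B"
    using B fB by (simp add: card_Diff_subset)
  finally show ?thesis by simp
qed

lemma spin_sum_empty:
  assumes "finite S" "card S = 2 * m"
  shows "spin_sum S {} = real ((2 * m) choose m)"
proof -
  have "balanced_subsets S = {B. B \<subseteq> S \<and> card B = m}"
    using assms by (auto simp: balanced_subsets_def)
  then show ?thesis using n_subsets[OF assms(1), of m] assms(2) by (simp add: spin_sum_def)
qed

text \<open>The transposition of \<open>x\<close> and \<open>y\<close> permutes the balanced subsets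
  of \<open>S\<close> and fixes \<open>T\<close> pointwise. This symmetry is why only the size of
  the index set matters.\<close>

lemma spin_sum_insert_exchange:
  assumes "finite S" "x \<in> S" "y \<in> S" "x \<notin> T" "y \<notin> T" "finite T"
  shows "spin_sum S (insert x T) = spin_sum S (insert y T)"
proof -
  let ?p = "transpose x y"
  have pS: "?p ` S = S" using assms by (auto simp: transpose_def image_iff)
  have inv: "?p ` ?p ` B = B" for B by (simp add: image_image)
  have cl: "?p ` B \<in> balanced_subsets S" if "B \<in> balanced_subsets S" for B
  proof -
    have "card (?p ` B) = card B" by (rule card_image) simp
    moreover have "?p ` B \<subseteq> S"
      using that pS image_mono[of B S ?p] by (simp add: balanced_subsets_def)
    ultimately show ?thesis using that by (simp add: balanced_subsets_def)
  qed
  have sp: "spin (?p ` B) e = spin B (?p e)" for B e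
  proof -
    have "e \<in> ?p ` B \<longleftrightarrow> ?p e \<in> B"
      by (metis image_eqI inv transpose_involutory)
    then show ?thesis by (simp add: spin_def)
  qed
  have "spin_sum S (insert y T) = (\<Sum>B\<in>balanced_subsets S. \<Prod>e\<in>insert y T. spin (?p ` B) e)"
    unfolding spin_sum_def
    by (rule sum.reindex_bij_witness[of _ "(`) ?p" "(`) ?p"]) (auto simp: inv cl)
  also have "\<dots> = (\<Sum>B\<in>balanced_subsets S. \<Prod>e\<in>insert x T. spin B e)"
  proof (rule sum.cong[OF refl])
    fix B
    have "(\<Prod>e\<in>T. spin B (?p e)) = (\<Prod>e\<in>T. spin B e)"
      using assms by (intro prod.cong refl) (auto simp: transpose_def)
    then show "(\<Prod>e\<in>insert y T. spin (?p ` B) e) = (\<Prod>e\<in>insert x T. spin B e)"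
      using assms by (simp add: sp)
  qed
  finally show ?thesis by (simp add: spin_sum_def)
qed

text \<open>When the product over \<open>T\<close> is multiplied by the total spin, a point outside
  \<open>T\<close> enlarges the index set, while a point of \<open>T\<close> is cancelled because
  spins square to 1. By the exchange symmetry all enlargements contribute equally, which gives the
  factor on the left.\<close>

lemma spin_sum_recursion:
  assumes "finite S" "T \<subseteq> S" "x \<in> S - T"
  shows "real (card S - card T) * spin_sum S (insert x T) = - (\<Sum>y\<in>T. spin_sum S (T - {y}))"
proof -
  have fT: "finite T" using assms finite_subset by blast
  have out: "(\<Prod>e\<in>insert y T. spin B e) = spin B y * (\<Prod>e\<in>T. spin B e)" if "y \<in> S - T" for y B
    using that fT by simp
  have ins: "(\<Prod>e\<in>T - {y}. spin B e) = spin B y * (\<Prod>e\<in>T. spin B e)" if "y \<in> T" for y B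
    using that fT by (simp add: prod.remove mult.assoc[symmetric])
  have "real (card S - card T) * spin_sum S (insert x T) = (\<Sum>y\<in>S - T. spin_sum S (insert x T))"
    using assms fT by (simp add: card_Diff_subset)
  also have "\<dots> = (\<Sum>y\<in>S - T. spin_sum S (insert y T))"
    using assms fT by (intro sum.cong refl spin_sum_insert_exchange) auto
  finally have "real (card S - card T) * spin_sum S (insert x T) + (\<Sum>y\<in>T. spin_sum S (T - {y}))
      = (\<Sum>y\<in>S - T. spin_sum S (insert y T)) + (\<Sum>y\<in>T. spin_sum S (T - {y}))" by simp
  also have "\<dots> = (\<Sum>y\<in>S - T. \<Sum>B\<in>balanced_subsets S. spin B y * (\<Prod>e\<in>T. spin B e))
      + (\<Sum>y\<in>T. \<Sum>B\<in>balanced_subsets S. spin B y * (\<Prod>e\<in>T. spin B e))"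
    unfolding spin_sum_def by (intro arg_cong2[where f = "(+)"] sum.cong refl out ins)
  also have "\<dots> = (\<Sum>y\<in>S. \<Sum>B\<in>balanced_subsets S. spin B y * (\<Prod>e\<in>T. spin B e))"
    using assms by (simp add: sum.subset_diff)
  also have "\<dots> = (\<Sum>B\<in>balanced_subsets S. (\<Sum>y\<in>S. spin B y) * (\<Prod>e\<in>T. spin B e))"
    by (subst sum.swap) (simp add: sum_distrib_right)
  also have "\<dots> = 0"
    using assms by (intro sum.neutral) (simp add: sum_spin_balanced)
  finally show ?thesis by linarith
qed

text \<open>This is the recursion of the spin sums with sign and power of two stripped off. The
  bound on \<open>k\<close> keeps \<open>Suc (Suc k)\<close> within row \<open>2 * m\<close>, so the
  binomials in the denominators are nonzero.\<close>

lemma s_seq_step: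
  assumes "Suc k < 2 * m"
  shows "real (2 * m - Suc k) * s_seq (2 * m) (Suc (Suc k)) = real (Suc k) * s_seq (2 * m) k"
proof (cases "even k")
  case True
  then obtain j where k: "k = 2 * j" by blast
  have j: "j < m" using assms k by simp
  let ?N = "2 * m"
  \<comment> \<open>The ratio of neighbouring binomials, kept free of division: it is used twice in
    row \<open>2 * m\<close> and once in row \<open>m\<close>.\<close>
  have up: "real (Suc i) * real (n choose Suc i) = (real n - real i) * real (n choose i)"
    if "i \<le> n" for n i
  proof -
    have "Suc i * (n choose Suc i) = (n - i) * (n choose i)"
      by (simp only: binomial_absorption binomial_absorb_comp)
    then have "real (Suc i * (n choose Suc i)) = real ((n - i) * (n choose i))" by simp
    then show ?thesis using that by (simp only: of_nat_mult of_nat_diff)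
  qed
  define a b c p q where "a = real (?N choose k)" and "b = real (?N choose Suc k)"
    and "c = real (?N choose Suc (Suc k))" and "p = real (m choose j)" and "q = real (m choose Suc j)"
  have e1: "(2 * real j + 1) * b = (2 * real m - 2 * real j) * a"
    using up[of k ?N] assms unfolding a_def b_def k by (simp add: algebra_simps)
  have e2: "(2 * real j + 2) * c = (2 * real m - 2 * real j - 1) * b"
    using up[of "Suc k" ?N] assms unfolding c_def b_def k by (simp add: algebra_simps)
  have e3: "(real j + 1) * q = (real m - real j) * p"
    using up[of j m] j unfolding p_def q_def by (simp add: algebra_simps)
  have pos: "a > 0" "c > 0" using assms by (auto simp: a_def c_def)
  \<comment> \<open>Two steps in row \<open>2 * m\<close> lead from \<open>c\<close> to
    \<open>a\<close>. The factor \<open>2 * real m - 2 * real j\<close> so produced is twice the one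
    in \<open>e3\<close>, which turns \<open>p\<close> into \<open>q\<close> and leaves the common
    factor \<open>2 * real j + 2\<close> to cancel.\<close>
  have "(2 * real j + 1) * (2 * real j + 2) * c * p = (2 * real j + 1) * ((2 * real j + 2) * c) * p"
    by (simp only: mult_ac)
  also have "\<dots> = (2 * real m - 2 * real j - 1) * ((2 * real j + 1) * b) * p"
    unfolding e2 by (simp only: mult_ac)
  also have "\<dots> = (2 * real m - 2 * real j - 1) * 2 * a * ((real m - real j) * p)"
    unfolding e1 by (simp add: algebra_simps)
  also have "\<dots> = (2 * real j + 2) * ((2 * real m - 2 * real j - 1) * q * a)"
    unfolding e3[symmetric] by (simp add: algebra_simps)
  finally have "(2 * real j + 2) * ((2 * real j + 1) * c * p)
      = (2 * real j + 2) * ((2 * real m - 2 * real j - 1) * q * a)" by (simp add: algebra_simps)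
  moreover have "2 * real j + 2 \<noteq> 0" by linarith
  ultimately have "(2 * real j + 1) * c * p = (2 * real m - 2 * real j - 1) * q * a"
    using mult_left_cancel by blast
  then have key: "(2 * real m - 2 * real j - 1) * q * a = (2 * real j + 1) * p * c"
    by (simp only: mult_ac)
  have L: "real (2 * m - Suc k) = 2 * real m - 2 * real j - 1" "real (Suc k) = 2 * real j + 1"
    using assms k by (simp_all add: of_nat_diff)
  have sk: "s_seq ?N k = real (?N choose m) / 2 ^ m * (p / a)"
    and sk2: "s_seq ?N (Suc (Suc k)) = real (?N choose m) / 2 ^ m * (q / c)"
    using k by (simp_all add: s_seq_def a_def p_def c_def q_def)
  have "(2 * real m - 2 * real j - 1) * (q / c) = (2 * real j + 1) * (p / a)"
    using key pos by (simp add: frac_eq_eq)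
  then show ?thesis unfolding L sk sk2 by (simp only: mult.left_commute)
qed (simp add: s_seq_def)

text \<open>Strong induction on the size of \<open>T\<close>: removing a point \<open>x\<close>
  leaves \<open>U\<close>, and the recursion at \<open>U\<close> leads to sets with two points fewer
  than \<open>T\<close>. Each such double step flips the sign once, hence the exponent
  \<open>card T div 2\<close>.\<close>

lemma spin_sum_eq_s_seq:
  assumes "finite S" "card S = 2 * m" "T \<subseteq> S"
  shows "spin_sum S T = (- 1) ^ (card T div 2) * 2 ^ m * s_seq (2 * m) (card T)"
  using assms(3)
proof (induction "card T" arbitrary: T rule: less_induct)
  case less
  have fT: "finite T" using less.prems assms(1) finite_subset by blast
  show ?case
  proof (cases "T = {}")
    case True
    then show ?thesis using spin_sum_empty[OF assms(1,2)] by (simp add: s_seq_def)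
  next
    case False
    then obtain x U where U: "T = insert x U" "x \<notin> U" by (meson all_not_in_conv mk_disjoint_insert)
    have fU: "finite U" and cT: "card T = Suc (card U)" using fT U by auto
    have lt: "card U < 2 * m" using card_mono[OF assms(1) less.prems] cT assms(2) by simp
    have rec: "real (2 * m - card U) * spin_sum S T = - (\<Sum>y\<in>U. spin_sum S (U - {y}))"
      using spin_sum_recursion[of S U x] assms less.prems U by auto
    have IH: "spin_sum S (U - {y})
        = (- 1) ^ ((card U - 1) div 2) * 2 ^ m * s_seq (2 * m) (card U - 1)" if "y \<in> U" for y
    proof -
      have "card (U - {y}) = card U - 1" "U - {y} \<subseteq> S" "card (U - {y}) < card T"
        using less.prems that U fU cT by auto
      then show ?thesis using less.hyps[of "U - {y}"] by simp
    qed
    \<comment> \<open>The claim is proved up to the factor \<open>2 * m - card U\<close>, which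
      \<open>lt\<close> makes positive. If \<open>U\<close> is empty, the recursion has an empty sum
      and both sides vanish, since \<open>s_seq\<close> is 0 at 1.\<close>
    have "real (2 * m - card U) * spin_sum S T
        = real (2 * m - card U) * ((- 1) ^ (card T div 2) * 2 ^ m * s_seq (2 * m) (card T))"
    proof (cases "card U")
      case 0
      then show ?thesis using rec fU cT by (simp add: s_seq_def)
    next
      case (Suc k)
      have "real (2 * m - card U) * spin_sum S T
          = - (real (Suc k) * ((- 1) ^ (k div 2) * 2 ^ m * s_seq (2 * m) k))"
        using rec IH Suc by simp
      also have "\<dots> = (- 1) ^ Suc (k div 2) * 2 ^ m * (real (Suc k) * s_seq (2 * m) k)"
        by simp
      also have "\<dots> = (- 1) ^ Suc (k div 2) * 2 ^ m
          * (real (2 * m - Suc k) * s_seq (2 * m) (Suc (Suc k)))"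
        using s_seq_step[of k m] lt Suc by simp
      finally show ?thesis using Suc cT by simp
    qed
    then show ?thesis using lt by simp
  qed
qed

section \<open>Eulerian orientations as balanced spin configurations\<close>

definition incident_edges :: "'a set set \<Rightarrow> 'a \<Rightarrow> 'a set set" where
  "incident_edges E v = {e \<in> E. v \<in> e}"

text \<open>\<open>B v\<close> collects the edges whose half at \<open>v\<close> has spin +1. The
  extensional product fixes the values outside \<open>V\<close>, so that configurations can be
  counted and sums over them factorise.\<close>

definition balanced_configs :: "'a set \<Rightarrow> 'a set set \<Rightarrow> ('a \<Rightarrow> 'a set set) set" where
  "balanced_configs V E = PiE V (\<lambda>v. balanced_subsets (incident_edges E v))"

text \<open>On a two-element edge this says that the two halves have opposite spins; the product
  form is the one that the expansion over subgraphs uses.\<close>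

definition antiparallel :: "('a \<Rightarrow> 'a set set) \<Rightarrow> 'a set \<Rightarrow> bool" where
  "antiparallel B e \<longleftrightarrow> (\<Prod>v\<in>e. spin (B v) e) = - 1"

lemma antiparallel_pair:
  "u \<noteq> v \<Longrightarrow> antiparallel B {u, v} \<longleftrightarrow> ({u, v} \<in> B u) \<noteq> ({u, v} \<in> B v)"
  by (simp add: antiparallel_def spin_def)

lemma antiparallel_indicator:
  assumes "card e = 2"
  shows "(1 + - (\<Prod>v\<in>e. spin (B v) e)) / 2 = (if antiparallel B e then 1 else 0)"
proof -
  obtain u v where "e = {u, v}" "u \<noteq> v" using assms by (auto simp: card_2_iff)
  then show ?thesis by (simp add: antiparallel_def spin_def)
qed

text \<open>\<open>tails\<close> and \<open>arcs\<close> will be mutually inverse translations. The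
  restricted abstraction makes \<open>tails V D\<close> extensional, as membership in
  \<open>balanced_configs\<close> demands.\<close>

definition tails :: "'a set \<Rightarrow> ('a \<times> 'a) set \<Rightarrow> 'a \<Rightarrow> 'a set set" where
  "tails V D = (\<lambda>u\<in>V. {{u, v} | v. (u, v) \<in> D})"

definition arcs :: "'a set \<Rightarrow> ('a \<Rightarrow> 'a set set) \<Rightarrow> ('a \<times> 'a) set" where
  "arcs V B = {(u, v). u \<in> V \<and> {u, v} \<in> B u}"

lemma finite_edges: "finite_graph V E \<Longrightarrow> finite E"
  unfolding finite_graph_def by (meson PowI finite_Pow_iff finite_subset subsetI)

lemma edgeE:
  assumes "finite_graph V E" "e \<in> E"
  obtains u v where "e = {u, v}" "u \<noteq> v" "u \<in> V" "v \<in> V"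
proof -
  have "e \<subseteq> V" "card e = 2" using assms by (auto simp: finite_graph_def)
  then show thesis using that by (auto simp: card_2_iff)
qed

lemma edge_pairD:
  assumes "finite_graph V E" "{u, v} \<in> E"
  shows "u \<noteq> v" "u \<in> V" "v \<in> V"
  using assms by (auto simp: finite_graph_def)

lemma orientation_arcD: "orientation E D \<Longrightarrow> (u, v) \<in> D \<Longrightarrow> {u, v} \<in> E"
  by (force simp: orientation_def bij_betw_def)

lemma orientation_edgeE:
  assumes "orientation E D" "{u, v} \<in> E"
  shows "(u, v) \<in> D \<or> (v, u) \<in> D"
proof -
  have "{u, v} \<in> (\<lambda>(u, v). {u, v}) ` D" using assms by (auto simp: orientation_def bij_betw_def)
  then show ?thesis by (auto simp: doubleton_eq_iff)
qed

text \<open>Opposite arcs lie over the same edge, so injectivity identifies them.\<close>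

lemma orientation_asym:
  assumes "orientation E D" "(u, v) \<in> D" "(v, u) \<in> D"
  shows "u = v"
  using assms unfolding orientation_def bij_betw_def inj_on_def by force

lemma mem_tails_iff:
  assumes "finite_graph V E" "orientation E D" "u \<in> V"
  shows "{u, v} \<in> tails V D u \<longleftrightarrow> (u, v) \<in> D"
  using assms by (auto simp: tails_def doubleton_eq_iff)

lemma card_tails:
  assumes "orientation E D" "u \<in> V"
  shows "card (tails V D u) = out_degree D u"
proof -
  have "tails V D u = (\<lambda>(u, v). {u, v}) ` {a \<in> D. fst a = u}"
    using assms by (auto simp: tails_def image_iff)
  moreover have "inj_on (\<lambda>(u, v). {u, v}) {a \<in> D. fst a = u}"
    by (auto simp: inj_on_def doubleton_eq_iff)
  ultimately show ?thesis by (simp add: card_image out_degree_def)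
qed

lemma degree_eq_in_out:
  assumes "finite_graph V E" "orientation E D"
  shows "degree_in E u = in_degree D u + out_degree D u"
proof -
  let ?f = "\<lambda>(u, v). {u, v}"
  have bij: "bij_betw ?f D E" using assms by (simp add: orientation_def)
  have fD: "finite D" using bij finite_edges[OF assms(1)] bij_betw_finite by blast
  have "{e \<in> E. u \<in> e} = ?f ` ({a \<in> D. snd a = u} \<union> {a \<in> D. fst a = u})"
    using bij by (auto simp: bij_betw_def)
  moreover have "inj_on ?f ({a \<in> D. snd a = u} \<union> {a \<in> D. fst a = u})"
    by (rule inj_on_subset[OF bij_betw_imp_inj_on[OF bij]]) auto
  moreover have "{a \<in> D. snd a = u} \<inter> {a \<in> D. fst a = u} = {}"
    using orientation_arcD[OF assms(2)] edge_pairD(1)[OF assms(1)] by fastforce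
  ultimately show ?thesis
    using fD by (simp add: degree_in_def in_degree_def out_degree_def card_image card_Un_disjoint)
qed

text \<open>Turns the Eulerian condition into one on tails alone, matching the shape of
  \<open>balanced_subsets\<close>.\<close>

lemma eulerian_iff_out_degree:
  assumes "finite_graph V E" "orientation E D"
  shows "in_degree D u = out_degree D u \<longleftrightarrow> 2 * out_degree D u = degree_in E u"
  using degree_eq_in_out[OF assms, of u] by auto

lemma tails_in_configs:
  assumes "finite_graph V E" "D \<in> eulerian_orientations V E"
  shows "tails V D \<in> {B \<in> balanced_configs V E. \<forall>e\<in>E. antiparallel B e}"
proof -
  have D: "orientation E D" "\<And>u. u \<in> V \<Longrightarrow> in_degree D u = out_degree D u"
    using assms(2) by (auto simp: eulerian_orientations_def)
  have "tails V D u \<in> balanced_subsets (incident_edges E u)" if "u \<in> V" for u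
  proof -
    have "tails V D u \<subseteq> incident_edges E u"
      using that orientation_arcD[OF D(1)] by (auto simp: tails_def incident_edges_def)
    moreover have "2 * card (tails V D u) = card (incident_edges E u)"
      using eulerian_iff_out_degree[OF assms(1) D(1), of u] card_tails[OF D(1) that] D(2)[OF that]
      by (simp add: degree_in_def incident_edges_def)
    ultimately show ?thesis by (simp add: balanced_subsets_def)
  qed
  moreover have "antiparallel (tails V D) e" if "e \<in> E" for e
  proof -
    obtain u v where e: "e = {u, v}" and uv: "u \<noteq> v" "u \<in> V" "v \<in> V"
      using edgeE[OF assms(1) \<open>e \<in> E\<close>] by blast
    \<comment> \<open>At least one of the two arcs is present because every edge is covered; both
      together would force \<open>u = v\<close>.\<close>
    have "((u, v) \<in> D) \<noteq> ((v, u) \<in> D)"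
      using orientation_edgeE[OF D(1)] orientation_asym[OF D(1)] that e uv by blast
    then show ?thesis
      using mem_tails_iff[OF assms(1) D(1)] uv
      by (simp add: e antiparallel_pair) (metis insert_commute)
  qed
  ultimately show ?thesis by (auto simp: balanced_configs_def tails_def)
qed

lemma config_memD:
  assumes "B \<in> balanced_configs V E" "u \<in> V" "e \<in> B u"
  shows "e \<in> E" "u \<in> e"
  using assms by (auto simp: balanced_configs_def balanced_subsets_def incident_edges_def PiE_def Pi_def)

text \<open>Antiparallelism says that exactly one end claims the edge as its tail: at most one gives
  injectivity, at least one gives surjectivity.\<close>

lemma orientation_arcs:
  assumes "finite_graph V E" "B \<in> balanced_configs V E" "\<forall>e\<in>E. antiparallel B e"
  shows "orientation E (arcs V B)"
  unfolding orientation_def bij_betw_def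
proof
  have arc: "{u, v} \<in> E" "u \<noteq> v" if "(u, v) \<in> arcs V B" for u v
  proof -
    show "{u, v} \<in> E" using that config_memD(1)[OF assms(2), of u "{u, v}"] by (simp add: arcs_def)
    then show "u \<noteq> v" by (rule edge_pairD(1)[OF assms(1)])
  qed
  have asym: False if "(u, v) \<in> arcs V B" "(v, u) \<in> arcs V B" for u v
  proof -
    have "antiparallel B {u, v}" using arc that assms(3) by blast
    then show False
      using that arc(2)[OF that(1)] by (simp add: antiparallel_pair arcs_def insert_commute)
  qed
  show "inj_on (\<lambda>(u, v). {u, v}) (arcs V B)"
    using asym by (fastforce simp: inj_on_def doubleton_eq_iff)
  show "(\<lambda>(u, v). {u, v}) ` arcs V B = E"
  proof
    show "(\<lambda>(u, v). {u, v}) ` arcs V B \<subseteq> E" using arc by auto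
    show "E \<subseteq> (\<lambda>(u, v). {u, v}) ` arcs V B"
    proof
      fix e assume eE: "e \<in> E"
      obtain u v where e: "e = {u, v}" and uv: "u \<noteq> v" "u \<in> V" "v \<in> V"
        using edgeE[OF assms(1) eE] by blast
      have "{u, v} \<in> B u \<or> {v, u} \<in> B v"
        using assms(3) eE e uv by (auto simp: antiparallel_pair insert_commute)
      then have "(u, v) \<in> arcs V B \<or> (v, u) \<in> arcs V B" using uv by (simp add: arcs_def)
      then show "e \<in> (\<lambda>(u, v). {u, v}) ` arcs V B" unfolding e by (force simp: insert_commute)
    qed
  qed
qed

lemma tails_arcs:
  assumes "finite_graph V E" "B \<in> balanced_configs V E"
  shows "tails V (arcs V B) = B"
proof
  fix u
  show "tails V (arcs V B) u = B u"
  proof (cases "u \<in> V")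
    case True
    \<comment> \<open>Every member of \<open>B u\<close> is an edge through \<open>u\<close>, so it
      is recovered from some arc with tail \<open>u\<close>.\<close>
    have "\<exists>v. e = {u, v}" if "e \<in> B u" for e
    proof -
      have "card e = 2" "u \<in> e"
        using config_memD[OF assms(2) True that] assms(1) by (auto simp: finite_graph_def)
      then show ?thesis by (auto simp: card_2_iff)
    qed
    then show ?thesis using True by (fastforce simp: tails_def arcs_def)
  next
    case False
    then show ?thesis using assms(2) by (auto simp: tails_def balanced_configs_def PiE_def extensional_def)
  qed
qed

lemma arcs_tails:
  assumes "finite_graph V E" "orientation E D"
  shows "arcs V (tails V D) = D"
proof -
  have "u \<in> V" if "(u, v) \<in> D" for u v
    using orientation_arcD[OF assms(2) that] edge_pairD[OF assms(1)] by blast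
  then show ?thesis using mem_tails_iff[OF assms] by (auto simp: arcs_def)
qed

lemma card_eulerian_orientations:
  assumes "finite_graph V E"
  shows "card (eulerian_orientations V E)
    = card {B \<in> balanced_configs V E. \<forall>e\<in>E. antiparallel B e}"
proof (rule bij_betw_same_card[of "tails V"], rule bij_betw_byWitness[where f' = "arcs V"])
  show "\<forall>D\<in>eulerian_orientations V E. arcs V (tails V D) = D"
    using arcs_tails[OF assms] by (auto simp: eulerian_orientations_def)
  show "\<forall>B\<in>{B \<in> balanced_configs V E. \<forall>e\<in>E. antiparallel B e}. tails V (arcs V B) = B"
    using tails_arcs[OF assms] by auto
  show "tails V ` eulerian_orientations V E
      \<subseteq> {B \<in> balanced_configs V E. \<forall>e\<in>E. antiparallel B e}"
    using tails_in_configs[OF assms] by blast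
  show "arcs V ` {B \<in> balanced_configs V E. \<forall>e\<in>E. antiparallel B e} \<subseteq> eulerian_orientations V E"
  proof clarify
    fix B assume B: "B \<in> balanced_configs V E" "\<forall>e\<in>E. antiparallel B e"
    have or: "orientation E (arcs V B)" by (rule orientation_arcs[OF assms B])
    have "in_degree (arcs V B) u = out_degree (arcs V B) u" if "u \<in> V" for u
    proof -
      have "2 * card (B u) = degree_in E u"
        using B(1) that
        by (auto simp: balanced_configs_def balanced_subsets_def incident_edges_def degree_in_def PiE_def Pi_def)
      \<comment> \<open>Since \<open>tails\<close> undoes \<open>arcs\<close>,
        \<open>card_tails\<close> reads \<open>card (B u)\<close> as the out-degree of
        \<open>u\<close> in \<open>arcs V B\<close>.\<close>
      then show ?thesis
        using eulerian_iff_out_degree[OF assms or, of u] card_tails[OF or that]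
          tails_arcs[OF assms B(1)] by simp
    qed
    then show "arcs V B \<in> eulerian_orientations V E" using or by (simp add: eulerian_orientations_def)
  qed
qed

section \<open>Expansion over subgraphs\<close>

text \<open>Double counting of incidences. It is used for \<open>E\<close> to collect the powers of
  two, and for a subgraph \<open>A\<close> to match the signs.\<close>

lemma handshake:
  assumes "finite_graph V E" "A \<subseteq> E"
  shows "(\<Sum>v\<in>V. degree_in A v) = 2 * card A"
proof -
  have fA: "finite A" using assms finite_edges finite_subset by blast
  have fV: "finite V" using assms(1) by (simp add: finite_graph_def)
  have "(\<Sum>v\<in>V. degree_in A v) = (\<Sum>v\<in>V. \<Sum>e\<in>{e \<in> A. v \<in> e}. 1)"
    by (simp add: degree_in_def)
  also have "\<dots> = (\<Sum>e\<in>A. \<Sum>v\<in>{v \<in> V. v \<in> e}. 1)"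
    by (rule sum.swap_restrict[OF fV fA])
  also have "\<dots> = (\<Sum>e\<in>A. 2)"
  proof (rule sum.cong[OF refl])
    fix e assume "e \<in> A"
    then have e: "e \<subseteq> V" "card e = 2" using assms by (auto simp: finite_graph_def)
    then have "{v \<in> V. v \<in> e} = e" by auto
    then show "(\<Sum>v\<in>{v \<in> V. v \<in> e}. 1) = (2::nat)" using e by simp
  qed
  finally show ?thesis by simp
qed

text \<open>Regrouping the half-edges of \<open>A\<close> by vertex instead of by edge makes each
  factor depend on a single \<open>B v\<close>; distributivity over the function space then splits
  the sum.\<close>

lemma sum_configs_factorise:
  assumes "finite_graph V E" "A \<subseteq> E"
  shows "(\<Sum>B\<in>balanced_configs V E. \<Prod>e\<in>A. \<Prod>v\<in>e. spin (B v) e)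
    = (\<Prod>v\<in>V. spin_sum (incident_edges E v) (incident_edges A v))"
proof -
  have fE: "finite E" and fV: "finite V"
    using assms(1) finite_edges by (auto simp: finite_graph_def)
  have fA: "finite A" using fE assms(2) finite_subset by blast
  have fin: "finite (incident_edges E v)" for v using fE by (simp add: incident_edges_def)
  have "(\<Prod>e\<in>A. \<Prod>v\<in>e. spin (B v) e) = (\<Prod>v\<in>V. \<Prod>e\<in>incident_edges A v. spin (B v) e)" for B
  proof -
    have "(\<Prod>e\<in>A. \<Prod>v\<in>e. spin (B v) e) = (\<Prod>e\<in>A. \<Prod>v\<in>{v \<in> V. v \<in> e}. spin (B v) e)"
    proof (rule prod.cong[OF refl])
      fix e assume "e \<in> A"
      then have "{v \<in> V. v \<in> e} = e" using assms by (auto simp: finite_graph_def)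
      then show "(\<Prod>v\<in>e. spin (B v) e) = (\<Prod>v\<in>{v \<in> V. v \<in> e}. spin (B v) e)" by simp
    qed
    also have "\<dots> = (\<Prod>v\<in>V. \<Prod>e\<in>{e \<in> A. v \<in> e}. spin (B v) e)"
      by (rule prod.swap_restrict[OF fA fV])
    finally show ?thesis by (simp add: incident_edges_def)
  qed
  then show ?thesis
    using prod_sum_PiE[OF fV, of "\<lambda>v. balanced_subsets (incident_edges E v)"
        "\<lambda>v B. \<Prod>e\<in>incident_edges A v. spin B e"] fin
    by (simp add: spin_sum_def balanced_configs_def)
qed

text \<open>The local factors \<open>2 ^ m\<close> multiply to \<open>2 ^ card E\<close> because
  \<open>card E = m * card V\<close>. The local signs combine to another
  \<open>(- 1) ^ card A\<close>, which cancels the one in front, unless some degree is odd and both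
  sides are 0.\<close>

lemma prod_spin_sum_eq:
  assumes "regular_graph (2 * m) V E" "A \<subseteq> E"
  shows "(- 1) ^ card A * (\<Prod>v\<in>V. spin_sum (incident_edges E v) (incident_edges A v))
    = 2 ^ card E * (\<Prod>v\<in>V. s_seq (2 * m) (degree_in A v))"
proof -
  have G: "finite_graph V E" and deg: "\<And>v. v \<in> V \<Longrightarrow> degree_in E v = 2 * m"
    using assms(1) by (auto simp: regular_graph_def)
  have fV: "finite V" using G by (simp add: finite_graph_def)
  have fE: "finite E" using G finite_edges by blast
  have "card V * (2 * m) = 2 * card E"
    using handshake[OF G subset_refl] deg by simp
  then have card_E: "card E = m * card V" by (simp add: algebra_simps)
  have "spin_sum (incident_edges E v) (incident_edges A v)
      = (- 1) ^ (degree_in A v div 2) * 2 ^ m * s_seq (2 * m) (degree_in A v)" if "v \<in> V" for v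
    using spin_sum_eq_s_seq[of "incident_edges E v" m "incident_edges A v"] deg[OF that] fE assms(2)
    by (auto simp: incident_edges_def degree_in_def)
  then have eq: "(\<Prod>v\<in>V. spin_sum (incident_edges E v) (incident_edges A v))
      = (- 1) ^ (\<Sum>v\<in>V. degree_in A v div 2) * 2 ^ card E
        * (\<Prod>v\<in>V. s_seq (2 * m) (degree_in A v))"
    by (simp add: prod.distrib power_sum card_E power_mult)
  show ?thesis
  proof (cases "\<forall>v\<in>V. even (degree_in A v)")
    case True
    \<comment> \<open>With all degrees even, the rounding in \<open>div\<close> loses nothing, so
      the handshake identity can be halved.\<close>
    then have "2 * (\<Sum>v\<in>V. degree_in A v div 2) = (\<Sum>v\<in>V. degree_in A v)"
      by (simp add: sum_distrib_left)
    then have "(\<Sum>v\<in>V. degree_in A v div 2) = card A" using handshake[OF G assms(2)] by simp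
    then show ?thesis unfolding eq by (simp add: power_add[symmetric] mult.assoc[symmetric])
  next
    case False
    then have "(\<Prod>v\<in>V. s_seq (2 * m) (degree_in A v)) = 0"
      using fV by (auto simp: s_seq_def intro!: prod_zero)
    then show ?thesis unfolding eq by simp
  qed
qed

theorem theorem5p1:
  fixes d :: nat and V :: "'a set" and E :: "'a set set"
  assumes "even d"
    and "regular_graph d V E"
  shows "subgraph_counting_poly V E (s_seq d) = real (card (eulerian_orientations V E))"
proof -
  obtain m where d: "d = 2 * m" using assms(1) by blast
  have G: "finite_graph V E" using assms(2) by (simp add: regular_graph_def)
  have fE: "finite E" and fV: "finite V"
    using G finite_edges by (auto simp: finite_graph_def)
  have fC: "finite (balanced_configs V E)"
    using fV fE by (auto simp: balanced_configs_def incident_edges_def intro!: finite_PiE)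
  let ?g = "\<lambda>B e. \<Prod>v\<in>e. spin (B v) e"
  \<comment> \<open>Here \<open>A\<close> is the set of edges from which the spin term is chosen
    when the product is expanded; its minus signs give \<open>(- 1) ^ card A\<close>.\<close>
  have ind: "(if \<forall>e\<in>E. antiparallel B e then 1 else 0)
      = (\<Sum>A\<in>Pow E. (- 1) ^ card A * (\<Prod>e\<in>A. ?g B e)) / 2 ^ card E" for B
  proof -
    have "(if \<forall>e\<in>E. antiparallel B e then 1 else 0)
        = (\<Prod>e\<in>E. if antiparallel B e then 1 else (0::real))"
      using fE by (auto intro!: prod_zero)
    also have "\<dots> = (\<Prod>e\<in>E. (1 + - ?g B e) / 2)"
      using G by (intro prod.cong refl antiparallel_indicator[symmetric]) (auto simp: finite_graph_def)
    also have "\<dots> = (\<Prod>e\<in>E. - ?g B e + 1) / 2 ^ card E"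
      by (simp add: prod_dividef add.commute)
    also have "(\<Prod>e\<in>E. - ?g B e + 1) = (\<Sum>A\<in>Pow E. (\<Prod>e\<in>A. - ?g B e) * (\<Prod>e\<in>E - A. 1))"
      by (rule prod_add[OF fE])
    finally show ?thesis by (simp add: prod_uminus)
  qed
  have "real (card (eulerian_orientations V E))
      = (\<Sum>B\<in>balanced_configs V E. if \<forall>e\<in>E. antiparallel B e then 1 else 0)"
    using fC by (simp add: card_eulerian_orientations[OF G] sum.If_cases Int_def)
  also have "\<dots> = (\<Sum>A\<in>Pow E. (- 1) ^ card A
      * (\<Sum>B\<in>balanced_configs V E. \<Prod>e\<in>A. ?g B e)) / 2 ^ card E"
    \<comment> \<open>Interchanging the sums leaves, for each fixed \<open>A\<close>, a sum over all
      balanced configurations without the edge condition, which is what factorises over the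
      vertices.\<close>
    unfolding ind sum_divide_distrib[symmetric] sum_distrib_left by (subst sum.swap) (rule refl)
  also have "\<dots> = (\<Sum>A\<in>Pow E. 2 ^ card E * (\<Prod>v\<in>V. s_seq d (degree_in A v))) / 2 ^ card E"
    using prod_spin_sum_eq[of m V E] assms(2) sum_configs_factorise[OF G] by (simp add: d)
  also have "\<dots> = subgraph_counting_poly V E (s_seq d)"
    by (simp add: sum_distrib_left[symmetric] subgraph_counting_poly_def)
  finally show ?thesis by simp
qed

end
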